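(* Let $\Omega\subset\mathbb{R}^n$ be open, $A\in\mathcal{A}(\Omega)$ and $p\in[1,\infty]$. Then $\Delta_p(A)=0$ if and only if $|1-2/p|=\mu(A)$. If these equalities are not satisfied then $$ \frac{\lambda_A}{\mu(A)}\leq\frac{\Delta_p(A)}{\mu(A)-|1-2/p|}\leq\Lambda_A . $$
   Context: $\langle z,w\rangle=\sum_jz_j\overline{w_j}$ on $\mathbb{C}^n$; $2/\infty=0$. $\mathcal{A}(\Omega)$ is the set of measurable $A:\Omega\to\mathbb{C}^{n\times n}$ for which there exist $\lambda,\Lambda>0$ such that for a.e. $x\in\Omega$: (1) $\mathrm{Re}\langle A(x)\xi,\xi\rangle\geq\lambda|\xi|^2$ for all $\xi\in\mathbb{C}^n$; (2) $|\langle A(x)\xi,\eta\rangle|\leq\Lambda|\xi||\eta|$ for all $\xi,\eta\in\mathbb{C}^n$. $\lambda_A$ is the largest admissible $\lambda$ in (1) and $\Lambda_A$ the smallest admissible $\Lambda$ in (2). For $p\in[1,\infty]$, $\mathcal{I}_p\xi=\xi+(1-2/p)\bar\xi$ and $\Delta_p(A)=\operatorname{ess\,inf}_{x\in\Omega}\min_{|\xi|=1}\mathrm{Re}\langle A(x)\xi,\mathcal{I}_p\xi\rangle$. $\mu(A)=\operatorname{ess\,inf}_{x\in\Omega}\varphi(x)$, where $\varphi(x)=\inf\frac{\mathrm{Re}\langle A(x)\xi,\xi\rangle}{|\langle A(x)\xi,\bar\xi\rangle|}\in\mathbb{R}\cup\{+\infty\}$, the infimum being over all $\xi\in\mathbb{C}^n$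 with $\langle A(x)\xi,\bar\xi\rangle\neq0$. *)

theory Defs
  imports "HOL-Analysis.Analysis"
begin

definition cdot :: "complex ^ 'n \<Rightarrow> complex ^ 'n \<Rightarrow> complex"
  where "cdot z w = (\<Sum>j\<in>UNIV. z $ j * cnj (w $ j))"

definition conj_vec :: "complex ^ 'n \<Rightarrow> complex ^ 'n"
  where "conj_vec \<xi> = (\<chi> j. cnj (\<xi> $ j))"

definition lower_bound ::
  "(real ^ 'n) set \<Rightarrow> (real ^ 'n \<Rightarrow> complex ^ 'n ^ 'n) \<Rightarrow> real \<Rightarrow> bool"
  where "lower_bound \<Omega> A l \<longleftrightarrow>
    (AE x in lebesgue_on \<Omega>. \<forall>\<xi>. Re (cdot (A x *v \<xi>) \<xi>) \<ge> l * (norm \<xi>)\<^sup>2)"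

definition upper_bound ::
  "(real ^ 'n) set \<Rightarrow> (real ^ 'n \<Rightarrow> complex ^ 'n ^ 'n) \<Rightarrow> real \<Rightarrow> bool"
  where "upper_bound \<Omega> A L \<longleftrightarrow>
    (AE x in lebesgue_on \<Omega>. \<forall>\<xi> \<eta>. cmod (cdot (A x *v \<xi>) \<eta>) \<le> L * norm \<xi> * norm \<eta>)"

text \<open>Matrix functions are total functions whose values outside \<open>\<Omega>\<close> are irrelevant.\<close>

definition elliptic_matrices ::
  "(real ^ 'n) set \<Rightarrow> (real ^ 'n \<Rightarrow> complex ^ 'n ^ 'n) set"
  where "elliptic_matrices \<Omega> =
    {A \<in> borel_measurable (lebesgue_on \<Omega>).
       \<exists>l > 0. \<exists>L > 0. lower_bound \<Omega> A l \<and> upper_bound \<Omega> A L}"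

text \<open>The largest admissible lower and the smallest admissible upper constant. Both extrema are
  attained when \<open>\<Omega>\<close> is open and nonempty and \<open>A\<close> is elliptic, since an intersection of countably
  many sets of full measure has full measure. Extended real values only matter for
  empty \<open>\<Omega>\<close>, where every constant is admissible.\<close>

definition lambda_of :: "(real ^ 'n) set \<Rightarrow> (real ^ 'n \<Rightarrow> complex ^ 'n ^ 'n) \<Rightarrow> ereal"
  where "lambda_of \<Omega> A = Sup {ereal l | l. l > 0 \<and> lower_bound \<Omega> A l}"

definition Lambda_of :: "(real ^ 'n) set \<Rightarrow> (real ^ 'n \<Rightarrow> complex ^ 'n ^ 'n) \<Rightarrow> ereal"
  where "Lambda_of \<Omega> A = Inf {ereal L | L. L > 0 \<and> upper_bound \<Omega> A L}"

text \<open>Dual to the library's essential supremum \<open>esssup\<close>, which is \<open>Limsup (ae_filter M) f\<close>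
  for measurable \<open>f\<close>.\<close>

definition essinf :: "'a measure \<Rightarrow> ('a \<Rightarrow> ereal) \<Rightarrow> ereal"
  where "essinf M f = Liminf (ae_filter M) f"

text \<open>For extended reals \<open>2 / \<infinity> = 0\<close>.\<close>

definition I_op :: "ereal \<Rightarrow> complex ^ 'n \<Rightarrow> complex ^ 'n"
  where "I_op p \<xi> = \<xi> + real_of_ereal (1 - 2 / p) *\<^sub>R conj_vec \<xi>"

text \<open>The inner infimum is a minimum, by compactness of the unit sphere.\<close>

definition Delta_p ::
  "(real ^ 'n) set \<Rightarrow> ereal \<Rightarrow> (real ^ 'n \<Rightarrow> complex ^ 'n ^ 'n) \<Rightarrow> ereal"
  where "Delta_p \<Omega> p A =
    essinf (lebesgue_on \<Omega>) (\<lambda>x. INF \<xi>\<in>{\<xi>. norm \<xi> = 1}. ereal (Re (cdot (A x *v \<xi>) (I_op p \<xi>))))"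

definition mu :: "(real ^ 'n) set \<Rightarrow> (real ^ 'n \<Rightarrow> complex ^ 'n ^ 'n) \<Rightarrow> ereal"
  where "mu \<Omega> A =
    essinf (lebesgue_on \<Omega>) (\<lambda>x.
      INF \<xi>\<in>{\<xi>. cdot (A x *v \<xi>) (conj_vec \<xi>) \<noteq> 0}.
        ereal (Re (cdot (A x *v \<xi>) \<xi>) / cmod (cdot (A x *v \<xi>) (conj_vec \<xi>))))"

end

theory Submission
  imports Defs
begin

text \<open>Since \<open>\<xi> \<mapsto> e\<^sup>i\<^sup>\<theta> \<xi>\<close> fixes \<open>\<langle>A\<xi>,\<xi>\<rangle>\<close> and rotates \<open>\<langle>A\<xi>,\<xi>\<^sup>*\<rangle>\<close> arbitrarily, both quantities are
  governed by \<open>a(\<xi>) = Re \<langle>A\<xi>,\<xi>\<rangle>\<close> and \<open>b(\<xi>) = |\<langle>A\<xi>,\<xi>\<^sup>*\<rangle>|\<close>: writing \<open>s = |1 - 2/p|\<close>, the bound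
  \<open>c \<le> \<Delta>\<^sub>p(A)\<close> means \<open>a - s b \<ge> c |\<xi>|\<^sup>2\<close> almost everywhere, and \<open>t \<le> \<mu>(A)\<close> means \<open>a \<ge> t b\<close> almost
  everywhere. Together with \<open>\<lambda> |\<xi>|\<^sup>2 \<le> a\<close> and \<open>a, b \<le> \<Lambda> |\<xi>|\<^sup>2\<close>, elementary inequalities translate
  one kind of bound into the other. On nonempty \<open>\<Omega>\<close>, testing with real \<open>\<xi>\<close> gives \<open>\<mu>(A) \<le> 1\<close>.\<close>

section \<open>Essential infima as almost-everywhere bounds\<close>

lemma AE_essinf_le: "AE x in M. essinf M f \<le> f x"
proof -
  \<comment> \<open>For each constant below the essential infimum the exceptional null set depends
    on the constant; restricting to rationals leaves countably many null sets to unite.\<close>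
  have "AE x in M. \<forall>q::rat. ereal (of_rat q) < essinf M f \<longrightarrow> ereal (of_rat q) < f x"
  proof (subst AE_all_countable, intro allI)
    fix q :: rat
    show "AE x in M. ereal (of_rat q) < essinf M f \<longrightarrow> ereal (of_rat q) < f x"
      by (cases "ereal (of_rat q) < essinf M f") (auto simp: essinf_def dest: less_LiminfD)
  qed
  then show ?thesis
  proof (eventually_elim)
    case (elim x)
    show ?case
    proof (rule ccontr)
      assume "\<not> essinf M f \<le> f x"
      then obtain r where "f x < ereal (of_rat r)" "ereal (of_rat r) < essinf M f"
        using ereal_dense3[of "f x" "essinf M f"] by (auto simp: not_le)
      with elim show False by (meson less_asym)
    qed
  qed
qed

lemma le_essinf_iff: "c \<le> essinf M f \<longleftrightarrow> (AE x in M. c \<le> f x)"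
proof
  assume c: "c \<le> essinf M f"
  show "AE x in M. c \<le> f x"
    using AE_essinf_le[of M f] by eventually_elim (use c in auto)
next
  assume "AE x in M. c \<le> f x"
  then show "c \<le> essinf M f" unfolding essinf_def by (rule Liminf_bounded)
qed

section \<open>Complex scalars and conjugation in the pairing \<open>cdot\<close>\<close>

lemma norm_conj_vec [simp]: "norm (conj_vec \<xi>) = norm \<xi>"
  by (simp add: norm_vec_def conj_vec_def)

lemma norm_vector_smult: "norm (u *s \<xi>) = cmod u * norm (\<xi> :: complex ^ 'n)"
  by (simp add: norm_vec_def norm_mult L2_set_right_distrib)

lemma matrix_vector_smult: "B *v (u *s \<xi>) = u *s (B *v (\<xi> :: complex ^ 'n))"
  by (simp add: vec_eq_iff matrix_vector_mult_def sum_distrib_left mult_ac)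

lemma cdot_smult: "cdot (B *v (u *s \<xi>)) (u *s \<xi>) = of_real ((cmod u)\<^sup>2) * cdot (B *v \<xi>) \<xi>"
  unfolding complex_norm_square
  by (simp add: matrix_vector_smult cdot_def sum_distrib_left mult_ac)

lemma cdot_conj_smult:
  "cdot (B *v (u *s \<xi>)) (conj_vec (u *s \<xi>)) = u\<^sup>2 * cdot (B *v \<xi>) (conj_vec \<xi>)"
  by (simp add: matrix_vector_smult cdot_def conj_vec_def sum_distrib_left mult_ac power2_eq_square)

lemma cdot_I_op:
  "cdot z (I_op p \<xi>) = cdot z \<xi> + of_real (real_of_ereal (1 - 2 / p)) * cdot z (conj_vec \<xi>)"
proof -
  have "cdot z (\<xi> + r *\<^sub>R w) = cdot z \<xi> + of_real r * cdot z w" for r w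
    by (simp add: cdot_def scaleR_sum_right sum.distrib ring_distribs flip: scaleR_conv_of_real)
  then show ?thesis unfolding I_op_def .
qed

section \<open>Pointwise criteria for a single matrix\<close>

lemma exists_unimodular_rotation:
  fixes q :: complex and r :: real
  obtains u where "cmod u = 1" "r * Re (u\<^sup>2 * q) = - \<bar>r\<bar> * cmod q"
proof -
  \<comment> \<open>\<open>cnj (sgn q)\<close> turns \<open>q\<close> onto the positive real axis;
    at \<open>q = 0\<close>, where \<open>sgn q\<close> vanishes, 1 serves as the unimodular
    factor.\<close>
  define v where "v = (if q = 0 then 1 else cnj (sgn q))"
  have v: "cmod v = 1" "v * q = of_real (cmod q)"
  proof -
    show "cmod v = 1" by (simp add: v_def norm_sgn)
    show "v * q = of_real (cmod q)"
      using complex_norm_square[of q]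
      by (auto simp: v_def sgn_eq power2_eq_square field_simps)
  qed
  \<comment> \<open>A square root, because scaling \<xi> by \<open>u\<close> multiplies the
    conjugate pairing by \<open>u\<^sup>2\<close>. The sign is opposite to that of \<open>r\<close>,
    which makes the product as small as possible.\<close>
  define u where "u = csqrt (if 0 \<le> r then - v else v)"
  have u2: "u\<^sup>2 = (if 0 \<le> r then - v else v)" by (simp add: u_def)
  have "(cmod u)\<^sup>2 = 1" using v(1) by (simp flip: norm_power add: u2)
  then have "cmod u = 1" by (simp add: power2_eq_1_iff) (metis norm_not_less_zero one_neq_neg_one
        neg_less_0_iff_less zero_less_one)
  moreover have "r * Re (u\<^sup>2 * q) = - \<bar>r\<bar> * cmod q"
  proof -
    have "u\<^sup>2 * q = of_real (if 0 \<le> r then - cmod q else cmod q)"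
      using v(2) by (simp add: u2)
    then show ?thesis by (simp only: Re_complex_of_real) simp
  qed
  ultimately show ?thesis using that by blast
qed

text \<open>Minimizing over the phase of \<xi> replaces \<open>r * Re q\<close> by
  \<open>- \<bar>r\<bar> * cmod q\<close>; homogeneity of degree two passes between the unit sphere
  and all vectors.\<close>

lemma le_INF_I_op_iff:
  fixes B :: "complex ^ 'n ^ 'n"
  shows "ereal c \<le> (INF \<xi>\<in>{\<xi>. norm \<xi> = 1}. ereal (Re (cdot (B *v \<xi>) (I_op p \<xi>)))) \<longleftrightarrow>
    (\<forall>\<xi>. c * (norm \<xi>)\<^sup>2 \<le> Re (cdot (B *v \<xi>) \<xi>)
        - \<bar>real_of_ereal (1 - 2 / p)\<bar> * cmod (cdot (B *v \<xi>) (conj_vec \<xi>)))"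
    (is "?L \<longleftrightarrow> ?R")
proof
  define r where "r = real_of_ereal (1 - 2 / p)"
  assume ?L
  then have L: "c \<le> Re (cdot (B *v \<xi>) \<xi>) + r * Re (cdot (B *v \<xi>) (conj_vec \<xi>))"
    if "norm \<xi> = 1" for \<xi>
    using that by (auto simp: le_INF_iff cdot_I_op r_def)
  show ?R
  proof
    fix \<xi> :: "complex ^ 'n"
    define q where "q = cdot (B *v \<xi>) (conj_vec \<xi>)"
    show "c * (norm \<xi>)\<^sup>2 \<le> Re (cdot (B *v \<xi>) \<xi>)
        - \<bar>real_of_ereal (1 - 2 / p)\<bar> * cmod (cdot (B *v \<xi>) (conj_vec \<xi>))"
    proof (cases "\<xi> = 0")
      case True
      then show ?thesis by (simp add: cdot_def)
    next
      case False
      obtain u where u: "cmod u = 1" "r * Re (u\<^sup>2 * q) = - \<bar>r\<bar> * cmod q"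
        by (rule exists_unimodular_rotation)
      \<comment> \<open>One scalar performs both the rotation and the normalization to the unit
        sphere.\<close>
      define w where "w = u / of_real (norm \<xi>)"
      have w: "cmod w = 1 / norm \<xi>" "w\<^sup>2 * q = (u\<^sup>2 * q) / of_real ((norm \<xi>)\<^sup>2)"
        using u by (auto simp: w_def norm_divide power_divide)
      have "norm (w *s \<xi>) = 1"
        using False by (simp add: norm_vector_smult w)
      from L[OF this] have "c \<le> (1 / norm \<xi>)\<^sup>2 * Re (cdot (B *v \<xi>) \<xi>)
          + r * (Re (u\<^sup>2 * q) / (norm \<xi>)\<^sup>2)"
        unfolding cdot_smult cdot_conj_smult q_def[symmetric] w Re_divide_of_real
        by simp
      also have "\<dots> = (Re (cdot (B *v \<xi>) \<xi>) + r * Re (u\<^sup>2 * q)) / (norm \<xi>)\<^sup>2"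
        by (simp add: power_divide add_divide_distrib)
      finally have "c * (norm \<xi>)\<^sup>2 \<le> Re (cdot (B *v \<xi>) \<xi>) + r * Re (u\<^sup>2 * q)"
        using False by (simp add: pos_le_divide_eq)
      then show ?thesis unfolding u(2) unfolding q_def r_def by simp
    qed
  qed
next
  define r where "r = real_of_ereal (1 - 2 / p)"
  assume R: ?R
  have "c \<le> Re (cdot (B *v \<xi>) \<xi>) + r * Re (cdot (B *v \<xi>) (conj_vec \<xi>))" if "norm \<xi> = 1" for \<xi>
  proof -
    define q where "q = cdot (B *v \<xi>) (conj_vec \<xi>)"
    have "c \<le> Re (cdot (B *v \<xi>) \<xi>) - \<bar>r\<bar> * cmod q"
      using R[rule_format, of \<xi>] that by (simp add: r_def q_def)
    moreover have "\<bar>r * Re q\<bar> \<le> \<bar>r\<bar> * cmod q"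
      by (simp add: abs_mult abs_Re_le_cmod mult_left_mono)
    ultimately show ?thesis unfolding q_def by linarith
  qed
  then show ?L by (auto simp: le_INF_iff cdot_I_op r_def)
qed

text \<open>The vectors left out of the infimum have vanishing conjugate pairing; for them the
  right-hand inequality is exactly the assumed nonnegativity.\<close>

lemma le_INF_quotient_iff:
  fixes B :: "complex ^ 'n ^ 'n"
  assumes "\<And>\<xi>. 0 \<le> Re (cdot (B *v \<xi>) \<xi>)"
  shows "ereal t \<le> (INF \<xi>\<in>{\<xi>. cdot (B *v \<xi>) (conj_vec \<xi>) \<noteq> 0}.
        ereal (Re (cdot (B *v \<xi>) \<xi>) / cmod (cdot (B *v \<xi>) (conj_vec \<xi>)))) \<longleftrightarrow>
    (\<forall>\<xi>. t * cmod (cdot (B *v \<xi>) (conj_vec \<xi>)) \<le> Re (cdot (B *v \<xi>) \<xi>))"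
proof -
  have "t \<le> Re (cdot (B *v \<xi>) \<xi>) / cmod (cdot (B *v \<xi>) (conj_vec \<xi>)) \<longleftrightarrow>
      t * cmod (cdot (B *v \<xi>) (conj_vec \<xi>)) \<le> Re (cdot (B *v \<xi>) \<xi>)"
    if "cdot (B *v \<xi>) (conj_vec \<xi>) \<noteq> 0" for \<xi>
    using that by (simp add: pos_le_divide_eq)
  then show ?thesis
    using assms by (auto simp: le_INF_iff) (metis mult_zero_right norm_zero)
qed

section \<open>Elliptic matrix functions with arbitrary admissible constants, and the range of
  \<open>mu\<close>\<close>

context
  fixes \<Omega> :: "(real ^ 'n) set" and A :: "real ^ 'n \<Rightarrow> complex ^ 'n ^ 'n"
    and l L :: real
  assumes l: "l > 0" "lower_bound \<Omega> A l"
    and L: "L > 0" "upper_bound \<Omega> A L"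
begin

lemma AE_elliptic_bounds:
  "AE x in lebesgue_on \<Omega>. \<forall>\<xi>. l * (norm \<xi>)\<^sup>2 \<le> Re (cdot (A x *v \<xi>) \<xi>) \<and>
     Re (cdot (A x *v \<xi>) \<xi>) \<le> L * (norm \<xi>)\<^sup>2 \<and>
     cmod (cdot (A x *v \<xi>) (conj_vec \<xi>)) \<le> L * (norm \<xi>)\<^sup>2"
  using l(2)[unfolded lower_bound_def] L(2)[unfolded upper_bound_def]
proof eventually_elim
  case (elim x)
  show ?case
  proof (intro allI conjI)
    fix \<xi>
    show "l * (norm \<xi>)\<^sup>2 \<le> Re (cdot (A x *v \<xi>) \<xi>)" using elim by blast
    have "Re (cdot (A x *v \<xi>) \<xi>) \<le> cmod (cdot (A x *v \<xi>) \<xi>)" by (rule complex_Re_le_cmod)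
    also have "\<dots> \<le> L * (norm \<xi>)\<^sup>2" using elim by (simp add: power2_eq_square mult.assoc)
    finally show "Re (cdot (A x *v \<xi>) \<xi>) \<le> L * (norm \<xi>)\<^sup>2" .
    have "cmod (cdot (A x *v \<xi>) (conj_vec \<xi>)) \<le> L * norm \<xi> * norm (conj_vec \<xi>)"
      using elim by blast
    then show "cmod (cdot (A x *v \<xi>) (conj_vec \<xi>)) \<le> L * (norm \<xi>)\<^sup>2"
      by (simp add: power2_eq_square mult.assoc)
  qed
qed

lemma le_mu_iff:
  "ereal t \<le> mu \<Omega> A \<longleftrightarrow> (AE x in lebesgue_on \<Omega>. \<forall>\<xi>.
     t * cmod (cdot (A x *v \<xi>) (conj_vec \<xi>)) \<le> Re (cdot (A x *v \<xi>) \<xi>))"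
  unfolding mu_def le_essinf_iff
proof (rule eventually_cong[OF AE_elliptic_bounds])
  fix x
  assume E: "\<forall>\<xi>. l * (norm \<xi>)\<^sup>2 \<le> Re (cdot (A x *v \<xi>) \<xi>) \<and>
     Re (cdot (A x *v \<xi>) \<xi>) \<le> L * (norm \<xi>)\<^sup>2 \<and>
     cmod (cdot (A x *v \<xi>) (conj_vec \<xi>)) \<le> L * (norm \<xi>)\<^sup>2"
  have "0 \<le> Re (cdot (A x *v \<xi>) \<xi>)" for \<xi>
  proof -
    have "0 \<le> l * (norm \<xi>)\<^sup>2" using l by simp
    with E show ?thesis by (meson order_trans)
  qed
  then show "ereal t \<le> (INF \<xi>\<in>{\<xi>. cdot (A x *v \<xi>) (conj_vec \<xi>) \<noteq> 0}.
        ereal (Re (cdot (A x *v \<xi>) \<xi>) / cmod (cdot (A x *v \<xi>) (conj_vec \<xi>)))) \<longleftrightarrow>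
    (\<forall>\<xi>. t * cmod (cdot (A x *v \<xi>) (conj_vec \<xi>)) \<le> Re (cdot (A x *v \<xi>) \<xi>))"
    by (rule le_INF_quotient_iff)
qed

text \<open>Dividing the lower bound on the real part by the upper bound on the conjugate pairing
  gives the uniform ratio \<open>l / L\<close>.\<close>

lemma mu_pos: "0 < mu \<Omega> A"
proof -
  have "ereal (l / L) \<le> mu \<Omega> A"
    unfolding le_mu_iff using AE_elliptic_bounds
  proof eventually_elim
    case (elim x)
    show ?case
    proof
      fix \<xi>
      have "l / L * cmod (cdot (A x *v \<xi>) (conj_vec \<xi>)) \<le> l / L * (L * (norm \<xi>)\<^sup>2)"
        using elim l L by (intro mult_left_mono) auto
      also have "\<dots> = l * (norm \<xi>)\<^sup>2" using L by simp
      also have "\<dots> \<le> Re (cdot (A x *v \<xi>) \<xi>)" using elim by blast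
      finally show "l / L * cmod (cdot (A x *v \<xi>) (conj_vec \<xi>)) \<le> Re (cdot (A x *v \<xi>) \<xi>)" .
    qed
  qed
  moreover have "0 < ereal (l / L)" using l L by simp
  ultimately show ?thesis by (rule less_le_trans[rotated])
qed

text \<open>Serves to make \<open>mu\<close> finite. A real vector equals its conjugate, so its
  quotient has the form \<open>Re q / cmod q\<close>.\<close>

lemma mu_le_one:
  assumes "open \<Omega>" "\<Omega> \<noteq> {}"
  shows "mu \<Omega> A \<le> 1"
proof (rule ccontr)
  assume "\<not> mu \<Omega> A \<le> 1"
  then obtain t where t: "1 < ereal t" "ereal t < mu \<Omega> A"
    using ereal_dense2[of 1 "mu \<Omega> A"] by (auto simp: not_le)
  then have "ereal t \<le> mu \<Omega> A" by simp
  then have G: "AE x in lebesgue_on \<Omega>. \<forall>\<xi>.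
     t * cmod (cdot (A x *v \<xi>) (conj_vec \<xi>)) \<le> Re (cdot (A x *v \<xi>) \<xi>)"
    unfolding le_mu_iff .
  define e :: "complex ^ 'n" where "e = (\<chi> i. 1)"
  have conj_e: "conj_vec e = e" and e0: "norm e \<noteq> 0"
    by (auto simp: e_def conj_vec_def vec_eq_iff)
  have "AE x in lebesgue_on \<Omega>. False"
    using G AE_elliptic_bounds
  proof eventually_elim
    case (elim x)
    define q where "q = cdot (A x *v e) e"
    have "0 < l * (norm e)\<^sup>2" using l e0 by simp
    also have "\<dots> \<le> Re q" using elim(2) by (simp add: q_def)
    finally have "0 < Re q" .
    moreover have "t * cmod q \<le> Re q" using elim(1)[rule_format, of e] by (simp add: q_def conj_e)
    moreover have "Re q \<le> cmod q" by (rule complex_Re_le_cmod)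
    moreover have "1 < t" using t(1) by (simp add: one_ereal_def)
    ultimately have "0 < cmod q" "t * cmod q \<le> 1 * cmod q" by linarith+
    with \<open>1 < t\<close> show False by (simp add: mult_le_cancel_right)
  qed
  \<comment> \<open>A property that fails everywhere yet holds almost everywhere on \<Omega> makes
    \<Omega> a null set, and a nonempty open set is not one.\<close>
  then have "AE x in lebesgue. x \<notin> \<Omega>"
    using assms(1) by (subst (asm) AE_restrict_space_iff) (auto simp: lborelD)
  then have "\<Omega> \<in> null_sets lebesgue"
    using assms(1) by (subst AE_iff_null_sets) (auto simp: lborelD)
  then have "\<Omega> = {}"
    using assms(1) open_not_negligible[of \<Omega>] by (auto simp: negligible_iff_null_sets)
  with assms(2) show False by simp
qed

section \<open>Comparison of \<open>Delta_p\<close> with \<open>mu\<close>\<close>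

context
  fixes p :: ereal and s :: real
  assumes s: "s = \<bar>real_of_ereal (1 - 2 / p)\<bar>"
begin

lemma le_Delta_p_iff:
  "ereal c \<le> Delta_p \<Omega> p A \<longleftrightarrow> (AE x in lebesgue_on \<Omega>. \<forall>\<xi>. c * (norm \<xi>)\<^sup>2 \<le>
     Re (cdot (A x *v \<xi>) \<xi>) - s * cmod (cdot (A x *v \<xi>) (conj_vec \<xi>)))"
  unfolding Delta_p_def le_essinf_iff le_INF_I_op_iff s ..

text \<open>With \<open>a\<close> and \<open>b\<close> as in the proof, the case
  \<open>s \<le> m\<close> uses \<open>a - s*b = (1 - s/m)*a + (s/m)*(a - m*b)\<close>, where
  \<open>a\<close> is bounded below through \<open>l\<close>. The case \<open>m \<le> s\<close> uses
  \<open>a - s*b = (a - m*b) - (s - m)*b\<close>, where \<open>b\<close> is bounded above through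
  \<open>L\<close>.\<close>

lemma Delta_p_ge:
  assumes m: "ereal m \<le> mu \<Omega> A" and "0 < m"
  shows "s \<le> m \<Longrightarrow> ereal (l * (m - s) / m) \<le> Delta_p \<Omega> p A"
    and "m \<le> s \<Longrightarrow> ereal (L * (m - s)) \<le> Delta_p \<Omega> p A"
proof -
  note G = m[unfolded le_mu_iff]
  have s0: "0 \<le> s" unfolding s by (rule abs_ge_zero)
  show "ereal (l * (m - s) / m) \<le> Delta_p \<Omega> p A" if "s \<le> m"
    unfolding le_Delta_p_iff using G AE_elliptic_bounds
  proof eventually_elim
    case (elim x)
    show ?case
    proof
      fix \<xi>
      define a b where "a = Re (cdot (A x *v \<xi>) \<xi>)" and "b = cmod (cdot (A x *v \<xi>) (conj_vec \<xi>))"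
      have "l * (m - s) / m * (norm \<xi>)\<^sup>2 = (1 - s / m) * (l * (norm \<xi>)\<^sup>2)"
        using \<open>0 < m\<close> by (simp add: field_simps)
      also have "\<dots> \<le> (1 - s / m) * a"
        using elim(2) that \<open>0 < m\<close> by (intro mult_left_mono) (auto simp: a_def)
      also have "\<dots> = a - s / m * a" by (simp add: algebra_simps)
      also have "\<dots> \<le> a - s / m * (m * b)"
        using elim(1) s0 \<open>0 < m\<close> by (intro diff_left_mono mult_left_mono) (auto simp: a_def b_def)
      also have "\<dots> = a - s * b" using \<open>0 < m\<close> by simp
      finally show "l * (m - s) / m * (norm \<xi>)\<^sup>2 \<le> Re (cdot (A x *v \<xi>) \<xi>)
          - s * cmod (cdot (A x *v \<xi>) (conj_vec \<xi>))" unfolding a_def b_def .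
    qed
  qed
  show "ereal (L * (m - s)) \<le> Delta_p \<Omega> p A" if "m \<le> s"
    unfolding le_Delta_p_iff using G AE_elliptic_bounds
  proof eventually_elim
    case (elim x)
    show ?case
    proof
      fix \<xi>
      define a b where "a = Re (cdot (A x *v \<xi>) \<xi>)" and "b = cmod (cdot (A x *v \<xi>) (conj_vec \<xi>))"
      have "(s - m) * b \<le> (s - m) * (L * (norm \<xi>)\<^sup>2)"
        using elim(2) that by (intro mult_left_mono) (auto simp: b_def)
      moreover have "m * b \<le> a" using elim(1) by (simp add: a_def b_def)
      ultimately have "L * (m - s) * (norm \<xi>)\<^sup>2 \<le> a - s * b" by (simp add: algebra_simps)
      then show "L * (m - s) * (norm \<xi>)\<^sup>2 \<le> Re (cdot (A x *v \<xi>) \<xi>)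
          - s * cmod (cdot (A x *v \<xi>) (conj_vec \<xi>))" unfolding a_def b_def .
    qed
  qed
qed

text \<open>The converse passage, by \<open>a - t*b = (a - s*b) - (t - s)*b\<close> in the first
  case and \<open>(s/t)*(a - t*b) = (a - s*b) + (s/t - 1)*a\<close> in the second; the bound on
  \<open>Delta_p\<close> is chosen so that the right-hand side is nonnegative.\<close>

lemma mu_ge:
  shows "s \<le> t \<Longrightarrow> ereal (L * (t - s)) \<le> Delta_p \<Omega> p A \<Longrightarrow> ereal t \<le> mu \<Omega> A"
    and "0 < t \<Longrightarrow> t \<le> s \<Longrightarrow> ereal (l * (t - s) / t) \<le> Delta_p \<Omega> p A \<Longrightarrow> ereal t \<le> mu \<Omega> A"
proof -
  show "ereal t \<le> mu \<Omega> A" if st: "s \<le> t" and D: "ereal (L * (t - s)) \<le> Delta_p \<Omega> p A"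
    unfolding le_mu_iff using D[unfolded le_Delta_p_iff] AE_elliptic_bounds
  proof eventually_elim
    case (elim x)
    show ?case
    proof
      fix \<xi>
      define a b where "a = Re (cdot (A x *v \<xi>) \<xi>)" and "b = cmod (cdot (A x *v \<xi>) (conj_vec \<xi>))"
      have "(t - s) * b \<le> (t - s) * (L * (norm \<xi>)\<^sup>2)"
        using elim(2) st by (intro mult_left_mono) (auto simp: b_def)
      moreover have "L * (t - s) * (norm \<xi>)\<^sup>2 \<le> a - s * b"
        using elim(1) by (simp add: a_def b_def)
      ultimately have "t * b \<le> a" by (simp add: algebra_simps)
      then show "t * cmod (cdot (A x *v \<xi>) (conj_vec \<xi>)) \<le> Re (cdot (A x *v \<xi>) \<xi>)"
        unfolding a_def b_def .
    qed
  qed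
  show "ereal t \<le> mu \<Omega> A"
    if t: "0 < t" "t \<le> s" and D: "ereal (l * (t - s) / t) \<le> Delta_p \<Omega> p A"
    unfolding le_mu_iff using D[unfolded le_Delta_p_iff] AE_elliptic_bounds
  proof eventually_elim
    case (elim x)
    show ?case
    proof
      fix \<xi>
      define a b where "a = Re (cdot (A x *v \<xi>) \<xi>)" and "b = cmod (cdot (A x *v \<xi>) (conj_vec \<xi>))"
      have "(s / t - 1) * (l * (norm \<xi>)\<^sup>2) \<le> (s / t - 1) * a"
        using elim(2) t by (intro mult_left_mono) (auto simp: a_def)
      moreover have "l * (t - s) / t * (norm \<xi>)\<^sup>2 \<le> a - s * b"
        using elim(1) by (simp add: a_def b_def)
      moreover have "l * (t - s) / t * (norm \<xi>)\<^sup>2 = - ((s / t - 1) * (l * (norm \<xi>)\<^sup>2))"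
        using t by (simp add: field_simps)
      ultimately have "s * b \<le> s / t * a" by (simp add: algebra_simps)
      then have "s * (t * b) \<le> s * a" using t by (simp add: field_simps)
      \<comment> \<open>Cancelling \<open>s\<close> is allowed since
        \<open>0 < t \<le> s\<close>.\<close>
      then have "t * b \<le> a" using t by (simp add: mult_le_cancel_left)
      then show "t * cmod (cdot (A x *v \<xi>) (conj_vec \<xi>)) \<le> Re (cdot (A x *v \<xi>) \<xi>)"
        unfolding a_def b_def .
    qed
  qed
qed

text \<open>If \<open>Delta_p\<close> exceeded the bound, some \<open>t > m\<close> would satisfy
  the premises of \<open>mu_ge\<close>, contradicting
  \<open>mu \<Omega> A = ereal m\<close>.\<close>

lemma Delta_p_le:
  assumes m: "mu \<Omega> A = ereal m"
  shows "s \<le> m \<Longrightarrow> Delta_p \<Omega> p A \<le> ereal (L * (m - s))"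
    and "m \<le> s \<Longrightarrow> Delta_p \<Omega> p A \<le> ereal (l * (m - s) / m)"
proof -
  have m0: "0 < m" using mu_pos m by simp
  show "Delta_p \<Omega> p A \<le> ereal (L * (m - s))" if sm: "s \<le> m"
  proof (rule ccontr)
    assume "\<not> ?thesis"
    then obtain c where c: "L * (m - s) < c" "ereal c < Delta_p \<Omega> p A"
      using ereal_dense2[of "ereal (L * (m - s))" "Delta_p \<Omega> p A"] by (auto simp: not_le)
    \<comment> \<open>The solution of \<open>L * (t - s) = c\<close>; it exceeds \<open>m\<close>
      because \<open>c > L * (m - s)\<close>.\<close>
    define t where "t = s + c / L"
    have t: "L * (t - s) = c" "m < t"
      using c L by (auto simp: t_def field_simps)
    then have "ereal t \<le> mu \<Omega> A" using c sm by (intro mu_ge(1)) auto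
    with m t show False by simp
  qed
  show "Delta_p \<Omega> p A \<le> ereal (l * (m - s) / m)" if ms: "m \<le> s"
  proof (rule ccontr)
    assume "\<not> ?thesis"
    then have D: "ereal (l * (m - s) / m) < Delta_p \<Omega> p A" by simp
    show False
    proof (cases "m = s")
      \<comment> \<open>Both bounds are 0 here, so the part already proved applies.\<close>
      case True
      then have "s \<le> m" "Delta_p \<Omega> p A > ereal (L * (m - s))" using D by auto
      with \<open>s \<le> m \<Longrightarrow> Delta_p \<Omega> p A \<le> ereal (L * (m - s))\<close> show False by simp
    next
      case False
      then have "l * (m - s) / m < 0" using ms m0 l by (simp add: divide_less_0_iff mult_less_0_iff)
      \<comment> \<open>The constant \<open>c\<close> is taken negative so that the \<open>t\<close>
        built from it satisfies \<open>t \<le> s\<close>; lying above \<open>l * (m - s) / m\<close>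
        forces \<open>m < t\<close>.\<close>
      then have "ereal (l * (m - s) / m) < min 0 (Delta_p \<Omega> p A)" using D by simp
      then obtain c where c: "l * (m - s) / m < c" "c < 0" "ereal c < Delta_p \<Omega> p A"
        using ereal_dense2[of "ereal (l * (m - s) / m)" "min 0 (Delta_p \<Omega> p A)"] by auto
      \<comment> \<open>the solution of \<open>l * (t - s) / t = c\<close>\<close>
      define t where "t = s * l / (l - c)"
      have lc: "0 < l - c" using c l by simp
      have s0: "0 < s" using ms m0 by simp
      have t0: "0 < t" using s0 l lc by (simp add: t_def)
      have tc: "t * (l - c) = s * l" using lc by (simp add: t_def)
      then have eq: "l * (t - s) / t = c" using t0 by (simp add: field_simps)
      have "t * (l - c) \<le> s * (l - c)" using tc s0 c by (simp add: algebra_simps mult_le_0_iff)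
      then have ts: "t \<le> s" using lc by (simp add: mult_le_cancel_right)
      have "l * (m - s) < c * m" using c(1) m0 by (simp add: pos_divide_less_eq)
      then have "m * (l - c) < t * (l - c)" using tc by (simp add: algebra_simps)
      then have "m < t" using lc by (simp add: mult_less_cancel_right)
      moreover have "ereal t \<le> mu \<Omega> A" using t0 ts c(3) eq by (intro mu_ge(2)) auto
      ultimately show False using m by simp
    qed
  qed
qed

end

end

text \<open>Division by \<open>m - s\<close> unifies the two cases: for \<open>m < s\<close> it
  reverses the inequalities, and the roles of the upper and lower bounds on \<open>d\<close> are
  exchanged. Since \<open>l\<close> and \<open>L\<close> are arbitrary admissible constants, extrema
  over them can be taken later.\<close>

lemma Delta_p_quotient_bounds:
  assumes l: "l > 0" "lower_bound \<Omega> A l" and L: "L > 0" "upper_bound \<Omega> A L"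
    and s: "s = \<bar>real_of_ereal (1 - 2 / p)\<bar>" and m: "mu \<Omega> A = ereal m"
    and d: "Delta_p \<Omega> p A = ereal d" and "m \<noteq> s"
  shows "l / m \<le> d / (m - s)" and "d / (m - s) \<le> L"
proof -
  have m0: "0 < m" using mu_pos[OF l L] m by simp
  note ge = Delta_p_ge[OF l L s, of m, unfolded m d, OF order_refl m0]
  note le = Delta_p_le[OF l L s m, unfolded d]
  have "l / m \<le> d / (m - s) \<and> d / (m - s) \<le> L"
  proof (cases "s < m")
    case True
    then have "l * (m - s) / m \<le> d" "d \<le> L * (m - s)" using ge le by auto
    then show ?thesis using True m0 by (simp add: field_simps)
  next
    case False
    then have ms: "m < s" using \<open>m \<noteq> s\<close> by simp
    then have "L * (m - s) \<le> d" "d \<le> l * (m - s) / m" using ge le by auto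
    \<comment> \<open>Rewritten with a positive denominator for clearing fractions.\<close>
    moreover have "d / (m - s) = (- d) / (s - m)" using minus_divide_divide[of d "m - s"] by simp
    ultimately show ?thesis using ms m0 by (simp add: field_simps)
  qed
  then show "l / m \<le> d / (m - s)" and "d / (m - s) \<le> L" by auto
qed

section \<open>Finiteness and passage to the optimal constants\<close>

lemma abs_one_minus_two_divide:
  assumes "1 \<le> (p :: ereal)"
  shows "\<bar>1 - 2 / p\<bar> = ereal \<bar>real_of_ereal (1 - 2 / p)\<bar>"
  \<comment> \<open>As \<open>p\<close> is not 0, \<open>2 / p\<close> is finite; at
    \<open>p = \<infinity>\<close> it is 0.\<close>
  using assms by (cases p) (auto simp: one_ereal_def numeral_eq_ereal)

theorem proposition5p15:
  fixes \<Omega> :: "(real ^ 'n) set"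
    and A :: "real ^ 'n \<Rightarrow> complex ^ 'n ^ 'n"
    and p :: ereal
  assumes "open \<Omega>"
    and "A \<in> elliptic_matrices \<Omega>"
    and "1 \<le> p"
  shows "(Delta_p \<Omega> p A = 0 \<longleftrightarrow> \<bar>1 - 2 / p\<bar> = mu \<Omega> A) \<and>
    (\<not> (Delta_p \<Omega> p A = 0 \<and> \<bar>1 - 2 / p\<bar> = mu \<Omega> A) \<longrightarrow>
      lambda_of \<Omega> A / mu \<Omega> A \<le> Delta_p \<Omega> p A / (mu \<Omega> A - \<bar>1 - 2 / p\<bar>) \<and>
      Delta_p \<Omega> p A / (mu \<Omega> A - \<bar>1 - 2 / p\<bar>) \<le> Lambda_of \<Omega> A)"
proof -
  define s where "s = \<bar>real_of_ereal (1 - 2 / p)\<bar>"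
  have s_eq: "\<bar>1 - 2 / p\<bar> = ereal s"
    unfolding s_def by (rule abs_one_minus_two_divide[OF assms(3)])
  show ?thesis
  proof (cases "\<Omega> = {}")
    case True
    \<comment> \<open>With no points, \<open>\<mu> = \<Delta>\<^sub>p = \<infinity>\<close>, and both quotients are \<open>\<infinity> / \<infinity> = 0\<close>.\<close>
    have AE: "AE x in lebesgue_on \<Omega>. P x" for P :: "real ^ 'n \<Rightarrow> bool"
      using True by (intro AE_I2) auto
    have "\<infinity> \<le> mu \<Omega> A" "\<infinity> \<le> Delta_p \<Omega> p A"
      unfolding mu_def Delta_p_def le_essinf_iff by (rule AE)+
    \<comment> \<open>The quotients being 0, the upper estimate reduces to this inequality.\<close>
    moreover have "0 \<le> Lambda_of \<Omega> A"
      unfolding Lambda_of_def by (rule Inf_greatest) auto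
    ultimately show ?thesis unfolding s_eq by simp
  next
    case False
    \<comment> \<open>One fixed admissible pair gives finiteness and the equivalence; optimality
      enters only at the end.\<close>
    obtain l0 L0 where l0: "l0 > 0" "lower_bound \<Omega> A l0" and L0: "L0 > 0" "upper_bound \<Omega> A L0"
      using assms(2) by (auto simp: elliptic_matrices_def)
    have "0 < mu \<Omega> A" "mu \<Omega> A \<le> 1"
      using mu_pos[OF l0 L0] mu_le_one[OF l0 L0 assms(1) False] by auto
    then obtain m where m: "mu \<Omega> A = ereal m" and m0: "0 < m"
      by (cases "mu \<Omega> A") auto
    note ge = Delta_p_ge[OF l0 L0 s_def, of m, unfolded m, OF order_refl m0]
    note le = Delta_p_le[OF l0 L0 s_def m]
    \<comment> \<open>\<open>Delta_p\<close> lies between two real bounds on either side of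
      \<open>s = m\<close>.\<close>
    obtain d where d: "Delta_p \<Omega> p A = ereal d"
      using ge le by (cases "Delta_p \<Omega> p A"; cases "s \<le> m") auto
    note quot = Delta_p_quotient_bounds[OF _ _ _ _ s_def m d]
    have zero_iff: "d = 0 \<longleftrightarrow> s = m"
    proof
      assume "d = 0"
      show "s = m"
      proof (rule ccontr)
        assume "s \<noteq> m"
        \<comment> \<open>For \<open>s \<noteq> m\<close> the quotient is bounded below by a
          positive number, so \<open>d\<close> cannot vanish.\<close>
        then have "l0 / m \<le> d / (m - s)" using l0 L0 by (intro quot(1)) auto
        moreover have "0 < l0 / m" using l0 m0 by simp
        ultimately show False using \<open>d = 0\<close> by simp
      qed
    next
      assume "s = m"
      then show "d = 0" using ge(1) le(1) by (simp add: d zero_ereal_def)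
    qed
    have "lambda_of \<Omega> A / ereal m \<le> ereal (d / (m - s)) \<and> ereal (d / (m - s)) \<le> Lambda_of \<Omega> A"
      if "m \<noteq> s"
    proof
      \<comment> \<open>\<open>l\<close> varies with \<open>L0\<close> fixed; for the upper estimate
        \<open>L\<close> varies with \<open>l0\<close> fixed.\<close>
      have "lambda_of \<Omega> A \<le> ereal (m * (d / (m - s)))"
        unfolding lambda_of_def
      proof (rule Sup_least, clarify)
        fix l assume l: "0 < l" "lower_bound \<Omega> A l"
        have "l / m \<le> d / (m - s)" by (rule quot(1)[OF l L0 that])
        then show "ereal l \<le> ereal (m * (d / (m - s)))" using m0 by (simp add: pos_divide_le_eq mult.commute)
      qed
      \<comment> \<open>The supremum is over a nonempty set and hence not
        \<open>- \<infinity>\<close>, a side condition for dividing by \<open>m\<close>.\<close>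
      moreover have "ereal l0 \<le> lambda_of \<Omega> A"
        unfolding lambda_of_def using l0 by (intro Sup_upper) auto
      then have "lambda_of \<Omega> A \<noteq> - \<infinity>" by auto
      ultimately show "lambda_of \<Omega> A / ereal m \<le> ereal (d / (m - s))"
        using m0 by (intro ereal_divide_le_posI) auto
      show "ereal (d / (m - s)) \<le> Lambda_of \<Omega> A"
        unfolding Lambda_of_def
      proof (rule Inf_greatest, clarify)
        fix L assume "0 < L" "upper_bound \<Omega> A L"
        then show "ereal (d / (m - s)) \<le> ereal L" using quot(2)[OF l0 _ _ that] by simp
      qed
    qed
    \<comment> \<open>By \<open>zero_iff\<close> the two equalities hold or fail together, so their
      failure means \<open>m \<noteq> s\<close>.\<close>
    then show ?thesis using zero_iff unfolding m d s_eq by (auto simp: zero_ereal_def)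
  qed
qed

end
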